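(* Let $(X,\|\cdot\|)$ be a Banach space, $T>0$, $J=[0,T]$, $0<\alpha<1$ and $x_0,y_0\in X$. Let $M_1>0$, $M_2>0$, $0<M_3<1$, and assume that $f,g:J\times X\times X\to X$ are continuous functions such that each $h\in\{f,g\}$ satisfies $$\|h(t_1,x_1,y_1)-h(t_2,x_2,y_2)\|\leq M_1|t_1-t_2|+M_2\|x_1-x_2\|+M_3\|y_1-y_2\|$$ for all $t_1,t_2\in J$ and $x_1,x_2,y_1,y_2\in X$. Suppose there exists $\eta\in L^1(J,\mathbb{R}_+)\cap C(J,\mathbb{R}_+)$ such that $$\|f(t,x,y)-g(t,x,y)\|\leq\eta(t),\quad t\in J,\ x,y\in X.$$ Suppose that $$\frac{M_2}{\Gamma(\alpha+1)}T^{\alpha}+M_3<1$$ and that $\theta>0$ is such that $\frac{M_2}{\theta}+M_3<1$. Then the solution $x^*$ of $${}^c_{0}\mathcal{D}_{t}^{\alpha}x(t)=f\left(t,x(t),{}^c_{0}\mathcal{D}_{t}^{\alpha}x(t)\right),\ t\in J,\qquad x(0)=x_0,$$ and the solution $y^*$ of $${}^c_{0}\mathcal{D}_{t}^{\alpha}x(t)=g\left(t,x(t),{}^c_{0}\mathcal{D}_{t}^{\alpha}x(t)\right),\ t\in J,\qquad x(0)=y_0,$$ satisfy the inequality $$\|x^*-y^*\|_B\leq\|x_0-y_0\|+\frac{K_\eta}{\theta\left[1-\left(\frac{M_2}{\theta}+M_3\right)\right]},$$ where $K_\eta=\max\{\eta(t):t\in J\}$.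
   Context: ${}^c_{0}\mathcal{D}_{t}^{\alpha}$ denotes the Caputo fractional derivative of order $\alpha$ with lower terminal $0$, given for $C^1$ functions by ${}^c_{0}\mathcal{D}_{t}^{\alpha}g(t)=\frac{1}{\Gamma(1-\alpha)}\int_0^t(t-\sigma)^{-\alpha}g'(\sigma)\,d\sigma$, $t>0$. Meaning of solution: a solution of ${}^c_{0}\mathcal{D}_{t}^{\alpha}x=h(t,x,{}^c_{0}\mathcal{D}_{t}^{\alpha}x)$, $x(0)=w$, is understood through the equivalent integral formulation, i.e. as a function $x:J\to X$ of the form $x(t)=w+\frac{1}{\Gamma(\alpha)}\int_0^t(t-s)^{\alpha-1}z(s)\,ds$, $t\in J$, where $z\in C(J,X)$ satisfies $z(t)=h\left(t,w+\frac{1}{\Gamma(\alpha)}\int_0^t(t-s)^{\alpha-1}z(s)\,ds,z(t)\right)$ for all $t\in J$. The Bielecki norm on $C(J,X)$ (continuous functions $J\to X$), for the given $\theta>0$, is $$\|x\|_B=\sup_{t\in J}\frac{\|x(t)\|}{\mathbb{E}_\alpha(\theta t^\alpha)},$$ where $\mathbb{E}_\alpha(u)=\sum_{k=0}^{\infty}\frac{u^k}{\Gamma(\alpha k+1)}$ is the Mittag-Leffler function. *)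

theory Defs
  imports "HOL-Analysis.Analysis"
begin

text \<open>
  The Riemann--Liouville fractional integral of order \<open>\<alpha>\<close> with lower terminal 0. The
  Henstock--Kurzweil integral is used because the library's Bochner integral requires a
  second-countable codomain, whereas the Banach space here is arbitrary. For continuous
  \<open>z\<close> and \<open>\<alpha> > 0\<close> the integrand is integrable (its value at the singularity \<open>s = t\<close> is irrelevant).
\<close>
definition frac_integral :: "real \<Rightarrow> (real \<Rightarrow> 'a::banach) \<Rightarrow> real \<Rightarrow> 'a" where
  "frac_integral \<alpha> z t =
     (1 / Gamma \<alpha>) *\<^sub>R integral {0..t} (\<lambda>s. ((t - s) powr (\<alpha> - 1)) *\<^sub>R z s)"

definition mittag_leffler :: "real \<Rightarrow> real \<Rightarrow> real" where
  "mittag_leffler \<alpha> u = (\<Sum>k. u ^ k / Gamma (\<alpha> * real k + 1))"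

text \<open>
  \<open>caputo_solution \<alpha> T h w x\<close>: the function \<open>x\<close> on \<open>[0, T]\<close> solves the implicit Caputo problem
  \<open>D\<^sup>\<alpha> x = h (t, x, D\<^sup>\<alpha> x)\<close>, \<open>x(0) = w\<close>, in the sense of its integral formulation, with \<open>z\<close>
  in the role of \<open>D\<^sup>\<alpha> x\<close>. Functions with domain \<open>[0, T]\<close> are represented extensionally, so
  that uniqueness of solutions is not spoilt by values outside \<open>[0, T]\<close>.
\<close>
definition caputo_solution ::
  "real \<Rightarrow> real \<Rightarrow> (real \<Rightarrow> 'a::banach \<Rightarrow> 'a \<Rightarrow> 'a) \<Rightarrow> 'a \<Rightarrow> (real \<Rightarrow> 'a) \<Rightarrow> bool" where
  "caputo_solution \<alpha> T h w x \<longleftrightarrow>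
     x \<in> extensional {0..T} \<and>
     (\<exists>z. continuous_on {0..T} z \<and>
          (\<forall>t\<in>{0..T}. z t = h t (w + frac_integral \<alpha> z t) (z t)) \<and>
          (\<forall>t\<in>{0..T}. x t = w + frac_integral \<alpha> z t))"

definition bielecki_norm :: "real \<Rightarrow> real \<Rightarrow> real \<Rightarrow> (real \<Rightarrow> 'a::banach) \<Rightarrow> real" where
  "bielecki_norm \<alpha> T \<theta> x =
     (SUP t\<in>{0..T}. norm (x t) / mittag_leffler \<alpha> (\<theta> * t powr \<alpha>))"

end

theory Submission
  imports Defs
begin

text \<open>
  Write \<open>I\<^sup>\<alpha>\<close> for the fractional integral, \<open>E(t)\<close> for the Mittag-Leffler weight of
  \<open>\<theta> t\<^sup>\<alpha>\<close>, \<open>D\<close> for the difference of the two solutions, \<open>d = x\<^sub>0 - y\<^sub>0\<close> and \<open>K\<close> for the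
  maximum of \<open>\<eta>\<close>.

  The weight is chosen so that \<open>I\<^sup>\<alpha>\<close> acts on it explicitly: \<open>I\<^sup>\<alpha> E = (E - 1) / \<theta>\<close>
  (\<open>frac_integral_mittag_leffler\<close>). The fractional derivatives \<open>u\<close>, \<open>v\<close> of the two solutions satisfy
  \<open>\<parallel>u - v\<parallel> \<le> K + M2 \<parallel>D\<parallel> + M3 \<parallel>u - v\<parallel>\<close>, and \<open>D = d + I\<^sup>\<alpha>(u - v)\<close>. Let \<open>B\<close> be the Bielecki
  norm of \<open>D\<close>, attained at \<open>\<tau>\<close>, and put \<open>\<mu> = \<theta> (1 - M3)\<close>. Bounding \<open>\<parallel>D\<parallel>\<close> by \<open>B E\<close>
  and \<open>K\<close> by \<open>K E\<close> under the integral gives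
  \<open>B E(\<tau>) \<le> \<parallel>d\<parallel> + (K + M2 B) / \<mu> (E(\<tau>) - 1)\<close>.
  The usual next step, discarding the \<open>-1\<close>, would leave the factor \<open>1 / (1 - M2 / \<mu>)\<close> on
  \<open>\<parallel>d\<parallel>\<close>. Keeping it, one divides by \<open>E(\<tau>)\<close> and sees that \<open>B\<close> is at most a convex
  combination of \<open>\<parallel>d\<parallel>\<close> and \<open>(K + M2 B) / \<mu>\<close>; hence \<open>B \<le> \<parallel>d\<parallel>\<close> or \<open>B \<le> K / (\<mu> - M2)\<close>,
  and \<open>\<mu> - M2 = \<theta> (1 - (M2 / \<theta> + M3))\<close>. So even the larger of the two terms of the claimed
  bound suffices, in place of their sum
  (\<open>norm_le_mittag_leffler_of_implicit_inequality\<close>).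

  Uniqueness is the case \<open>d = 0\<close>, \<open>K = 0\<close> of this estimate. Existence is Banach's fixed point
  theorem in the sup norm for \<open>z \<mapsto> h(t, w + I\<^sup>\<alpha> z(t), z(t))\<close>, whose contraction constant is
  \<open>M2 T\<^sup>\<alpha> / \<Gamma>(\<alpha> + 1) + M3\<close> (\<open>ex_implicit_fractional_fixpoint\<close>).

  All analytic properties of \<open>I\<^sup>\<alpha>\<close> on functions with values in an arbitrary Banach space are
  read off from one formula that removes the singular kernel (\<open>frac_integral_rescaled\<close>).
\<close>

section \<open>The fractional integral without its singular kernel\<close>

lemma frac_node_in:
  fixes \<alpha> t u :: real
  assumes "0 < \<alpha>" and "0 \<le> t" and "u \<in> {0..1}"
  shows "t * (1 - u powr (1 / \<alpha>)) \<in> {0..t}"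
  using assms powr_mono2[of "1/\<alpha>" u 1] mult_left_le[of "1 - u powr (1 / \<alpha>)" t] by auto

lemma continuous_on_frac_node:
  fixes z :: "real \<Rightarrow> 'a::topological_space"
  assumes "0 < \<alpha>" and "0 \<le> t" and z: "continuous_on {0..t} z"
  shows "continuous_on {0..1} (\<lambda>u. z (t * (1 - u powr (1 / \<alpha>))))"
  by (rule continuous_on_compose2[OF z])
     (use assms frac_node_in in \<open>auto intro!: continuous_intros continuous_on_powr'\<close>)

text \<open>
  The substitution \<open>u = (1 - s / t)\<^sup>\<alpha>\<close> turns the kernel \<open>(t - s)\<^sup>\<alpha>\<^sup>-\<^sup>1 ds\<close> into
  \<open>t\<^sup>\<alpha> / \<alpha> du\<close> up to sign, leaving a continuous integrand on an interval that does not depend on \<open>t\<close>.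
  It is carried out through an explicit antiderivative: the fundamental theorem of calculus
  yields integrability of the singular integrand as well, for values in any Banach space.
\<close>
lemma frac_integral_rescaled:
  fixes z :: "real \<Rightarrow> 'a::banach"
  assumes "0 < \<alpha>" and "0 \<le> t" and z: "continuous_on {0..t} z"
  shows "frac_integral \<alpha> z t =
    (t powr \<alpha> / Gamma (\<alpha> + 1)) *\<^sub>R integral {0..1} (\<lambda>u. z (t * (1 - u powr (1 / \<alpha>))))"
proof (cases "t = 0")
  case True
  then show ?thesis by (simp add: frac_integral_def)
next
  case False
  with assms have t: "t > 0" by simp
  define \<zeta> where "\<zeta> u = z (t * (1 - u powr (1 / \<alpha>)))" for u
  define F where "F u = integral {0..u} \<zeta>" for u
  define q where "q s = (1 - s / t) powr \<alpha>" for s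
  have \<zeta>: "continuous_on {0..1} \<zeta>"
    unfolding \<zeta>_def using assms by (rule continuous_on_frac_node)
  have F: "continuous_on {0..1} F"
    unfolding F_def by (rule indefinite_integral_continuous_1) (rule integrable_continuous_real[OF \<zeta>])
  have q01: "q s \<in> {0..1}" if "s \<in> {0..t}" for s
    using that t \<open>0 < \<alpha>\<close> powr_mono2[of \<alpha> "1 - s/t" 1] by (auto simp: q_def)
  have qcont: "continuous_on {0..t} q"
    unfolding q_def using t \<open>0 < \<alpha>\<close> by (auto intro!: continuous_intros continuous_on_powr')
  \<comment> \<open>The antiderivative need not be differentiable at \<open>s = t\<close>, but it is continuous there,
    so interior derivatives suffice.\<close>
  have "((\<lambda>s. (t - s) powr (\<alpha> - 1) *\<^sub>R z s) has_integral
      - (t powr \<alpha> / \<alpha>) *\<^sub>R F (q t) - (- (t powr \<alpha> / \<alpha>) *\<^sub>R F (q 0))) {0..t}"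
  proof (rule fundamental_theorem_of_calculus_interior)
    show "continuous_on {0..t} (\<lambda>s. - (t powr \<alpha> / \<alpha>) *\<^sub>R F (q s))"
      by (intro continuous_intros continuous_on_compose2[OF F qcont]) (use q01 in auto)
  next
    fix s assume s: "s \<in> {0<..<t}"
    have pos: "0 < 1 - s / t" "1 - s / t < 1" using s t by auto
    have q: "0 < q s" "q s < 1"
      using pos \<open>0 < \<alpha>\<close> powr_less_mono2[of \<alpha> "1 - s/t" 1] by (auto simp: q_def)
    have dF: "(F has_vector_derivative \<zeta> (q s)) (at (q s))"
      using integral_has_vector_derivative[OF \<zeta>, of "q s"] q
      by (simp add: F_def[abs_def] at_within_Icc_at)
    have dq: "(q has_vector_derivative (- (\<alpha> * (1 - s / t) powr (\<alpha> - 1) / t))) (at s)"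
      unfolding has_real_derivative_iff_has_vector_derivative[symmetric] q_def
      using pos t by (auto intro!: derivative_eq_intros simp: field_simps powr_diff)
    have "\<zeta> (q s) = z s"
      using pos t \<open>0 < \<alpha>\<close> by (simp add: \<zeta>_def q_def powr_powr field_simps)
    moreover have "t powr \<alpha> * (1 - s / t) powr (\<alpha> - 1) / t = (t - s) powr (\<alpha> - 1)"
    proof -
      have "(t - s) powr (\<alpha> - 1) = (t * (1 - s / t)) powr (\<alpha> - 1)"
        using t by (simp add: right_diff_distrib)
      also have "\<dots> = t powr (\<alpha> - 1) * (1 - s / t) powr (\<alpha> - 1)"
        using t pos by (subst powr_mult) auto
      finally show ?thesis using t by (simp add: powr_diff)
    qed
    ultimately have "(t - s) powr (\<alpha> - 1) *\<^sub>R z s =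
        - (t powr \<alpha> / \<alpha>) *\<^sub>R (- (\<alpha> * (1 - s / t) powr (\<alpha> - 1) / t)) *\<^sub>R \<zeta> (q s)"
      using \<open>0 < \<alpha>\<close> by (simp add: field_simps)
    moreover have "((\<lambda>s. - (t powr \<alpha> / \<alpha>) *\<^sub>R F (q s)) has_vector_derivative
        - (t powr \<alpha> / \<alpha>) *\<^sub>R (- (\<alpha> * (1 - s / t) powr (\<alpha> - 1) / t)) *\<^sub>R \<zeta> (q s)) (at s)"
      using vector_diff_chain_at[OF dq dF]
      by (intro derivative_eq_intros) (auto simp: o_def)
    ultimately show "((\<lambda>s. - (t powr \<alpha> / \<alpha>) *\<^sub>R F (q s)) has_vector_derivative
        (t - s) powr (\<alpha> - 1) *\<^sub>R z s) (at s)" by simp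
  qed (use t in auto)
  then have "integral {0..t} (\<lambda>s. (t - s) powr (\<alpha> - 1) *\<^sub>R z s) = (t powr \<alpha> / \<alpha>) *\<^sub>R F 1"
    using t \<open>0 < \<alpha>\<close> by (subst integral_unique) (auto simp: q_def F_def)
  moreover have "Gamma (\<alpha> + 1) = \<alpha> * Gamma \<alpha>"
    using \<open>0 < \<alpha>\<close> by (intro Gamma_plus1) (auto elim!: nonpos_Ints_cases)
  ultimately show ?thesis
    by (simp add: frac_integral_def F_def \<zeta>_def[abs_def])
qed

lemma continuous_on_frac_integral:
  fixes z :: "real \<Rightarrow> 'a::banach"
  assumes "0 < \<alpha>" and z: "continuous_on {0..T} z"
  shows "continuous_on {0..T} (frac_integral \<alpha> z)"
proof -
  have "continuous_on ({0..T} \<times> cbox 0 1) (\<lambda>(t, u). z (t * (1 - u powr (1 / \<alpha>))))"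
    unfolding case_prod_unfold
  proof (rule continuous_on_compose2[OF z])
    show "continuous_on ({0..T} \<times> cbox 0 1) (\<lambda>p. fst p * (1 - snd p powr (1 / \<alpha>)))"
      using \<open>0 < \<alpha>\<close> by (auto intro!: continuous_intros continuous_on_powr')
    show "(\<lambda>p. fst p * (1 - snd p powr (1 / \<alpha>))) ` ({0..T} \<times> cbox 0 1) \<subseteq> {0..T}"
      using frac_node_in[OF \<open>0 < \<alpha>\<close>] by fastforce
  qed
  from integral_continuous_on_param[OF this]
  have "continuous_on {0..T} (\<lambda>t. (t powr \<alpha> / Gamma (\<alpha> + 1)) *\<^sub>R
      integral (cbox 0 1) (\<lambda>u. z (t * (1 - u powr (1 / \<alpha>)))))"
    using \<open>0 < \<alpha>\<close> Gamma_real_pos[of "\<alpha> + 1"]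
    by (intro continuous_on_scaleR continuous_on_divide continuous_on_powr' continuous_intros)
       (auto simp: less_imp_neq[symmetric])
  then show ?thesis
    by (rule continuous_on_eq)
       (subst frac_integral_rescaled, use assms in \<open>auto intro: continuous_on_subset\<close>)
qed

lemma norm_frac_integral_le:
  fixes z :: "real \<Rightarrow> 'a::banach"
  assumes "0 < \<alpha>" and "0 \<le> t" and z: "continuous_on {0..t} z" and \<phi>: "continuous_on {0..t} \<phi>"
    and le: "\<And>s. s \<in> {0..t} \<Longrightarrow> norm (z s) \<le> \<phi> s"
  shows "norm (frac_integral \<alpha> z t) \<le> frac_integral \<alpha> \<phi> t"
proof -
  have "norm (integral {0..1} (\<lambda>u. z (t * (1 - u powr (1 / \<alpha>)))))
      \<le> integral {0..1} (\<lambda>u. \<phi> (t * (1 - u powr (1 / \<alpha>))))"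
    by (intro Henstock_Kurzweil_Integration.integral_norm_bound_integral
          integrable_continuous_real continuous_on_frac_node le frac_node_in assms(1,2) z \<phi>)
  then show ?thesis
    using assms Gamma_real_pos[of "\<alpha> + 1"]
    by (simp add: frac_integral_rescaled divide_right_mono mult_left_mono)
qed

lemma frac_integral_add:
  fixes z1 z2 :: "real \<Rightarrow> 'a::banach"
  assumes "0 < \<alpha>" and "0 \<le> t" and "continuous_on {0..t} z1" and "continuous_on {0..t} z2"
  shows "frac_integral \<alpha> (\<lambda>s. z1 s + z2 s) t = frac_integral \<alpha> z1 t + frac_integral \<alpha> z2 t"
  using assms
  by (simp add: frac_integral_rescaled continuous_on_add continuous_on_frac_node
      integrable_continuous_real Henstock_Kurzweil_Integration.integral_add scaleR_right_distrib)

lemma frac_integral_scaleR: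
  "frac_integral \<alpha> (\<lambda>s. c *\<^sub>R z s) t = c *\<^sub>R frac_integral \<alpha> z t"
  using integral_cmul[of "{0..t}" c "\<lambda>s. (t - s) powr (\<alpha> - 1) *\<^sub>R z s"]
  by (simp add: frac_integral_def mult.commute)

lemma frac_integral_diff:
  fixes z1 z2 :: "real \<Rightarrow> 'a::banach"
  assumes "0 < \<alpha>" and "0 \<le> t" and "continuous_on {0..t} z1" and "continuous_on {0..t} z2"
  shows "frac_integral \<alpha> (\<lambda>s. z1 s - z2 s) t = frac_integral \<alpha> z1 t - frac_integral \<alpha> z2 t"
  using frac_integral_add[of \<alpha> t z1 "\<lambda>s. (-1) *\<^sub>R z2 s"] frac_integral_scaleR[of \<alpha> "-1" z2 t] assms
  by (simp add: continuous_on_minus)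

lemma frac_integral_const:
  assumes "0 < \<alpha>" and "0 \<le> t"
  shows "frac_integral \<alpha> (\<lambda>_. c) t = (t powr \<alpha> / Gamma (\<alpha> + 1)) *\<^sub>R c"
  using assms by (simp add: frac_integral_rescaled)

lemma frac_integral_sum:
  fixes z :: "'i \<Rightarrow> real \<Rightarrow> 'a::banach"
  assumes "0 < \<alpha>" and "0 \<le> t" and "\<And>i. i \<in> I \<Longrightarrow> continuous_on {0..t} (z i)"
  shows "frac_integral \<alpha> (\<lambda>s. \<Sum>i\<in>I. z i s) t = (\<Sum>i\<in>I. frac_integral \<alpha> (z i) t)"
  using assms(3)
proof (induction I rule: infinite_finite_induct)
  case (insert i I)
  then show ?case
    using assms(1,2) by (simp add: frac_integral_add continuous_on_sum)
qed (simp_all add: frac_integral_def)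

text \<open>Needed to integrate the Mittag-Leffler series term by term.\<close>
lemma tendsto_frac_integral:
  fixes z :: "nat \<Rightarrow> real \<Rightarrow> 'a::banach"
  assumes "0 < \<alpha>" and "0 \<le> t" and z: "\<And>n. continuous_on {0..t} (z n)"
    and lim: "uniform_limit {0..t} z y sequentially"
  shows "(\<lambda>n. frac_integral \<alpha> (z n) t) \<longlonglongrightarrow> frac_integral \<alpha> y t"
proof -
  have y: "continuous_on {0..t} y"
    by (rule uniform_limit_theorem[OF _ lim]) (use z in auto)
  have "uniform_limit {0..1} (\<lambda>n u. z n (t * (1 - u powr (1 / \<alpha>))))
      (\<lambda>u. y (t * (1 - u powr (1 / \<alpha>)))) sequentially"
    by (rule uniform_limit_compose'[OF lim]) (use frac_node_in assms in blast)
  from uniform_limit_integral[OF this continuous_on_frac_node[OF assms(1,2) z] sequentially_bot]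
  obtain I J where IJ: "\<And>n. ((\<lambda>u. z n (t * (1 - u powr (1 / \<alpha>)))) has_integral I n) {0..1}"
    "((\<lambda>u. y (t * (1 - u powr (1 / \<alpha>)))) has_integral J) {0..1}" "I \<longlonglongrightarrow> J"
    by metis
  have "(\<lambda>n. frac_integral \<alpha> (z n) t) = (\<lambda>n. (t powr \<alpha> / Gamma (\<alpha> + 1)) *\<^sub>R I n)"
    "frac_integral \<alpha> y t = (t powr \<alpha> / Gamma (\<alpha> + 1)) *\<^sub>R J"
    using assms(1,2) z y integral_unique[OF IJ(1)] integral_unique[OF IJ(2)]
    by (simp_all add: frac_integral_rescaled)
  with IJ(3) show ?thesis
    by (simp add: tendsto_scaleR)
qed

text \<open>
  The rescaled formula shows that the left-hand side is homogeneous in \<open>t\<close> of degree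
  \<open>p + \<alpha>\<close>; its value at \<open>t = 1\<close> is a Beta integral.
\<close>
lemma frac_integral_powr:
  assumes "0 < \<alpha>" and "0 < p" and "0 \<le> t"
  shows "frac_integral \<alpha> (\<lambda>s. s powr p) t = Gamma (p + 1) / Gamma (p + \<alpha> + 1) * t powr (p + \<alpha>)"
proof -
  define N where "N = integral {0..1} (\<lambda>u::real. (1 - u powr (1 / \<alpha>)) powr p)"
  have cont: "continuous_on {0..s} (\<lambda>s. s powr p)" for s :: real
    by (rule continuous_on_powr') (use \<open>0 < p\<close> in \<open>auto intro!: continuous_intros\<close>)
  have scaled: "frac_integral \<alpha> (\<lambda>s. s powr p) t = t powr (p + \<alpha>) * (N / Gamma (\<alpha> + 1))"
    if "0 \<le> t" for t
  proof -
    have "integral {0..1} (\<lambda>u. (t * (1 - u powr (1 / \<alpha>))) powr p)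
        = integral {0..1} (\<lambda>u. t powr p * (1 - u powr (1 / \<alpha>)) powr p)"
      by (intro Henstock_Kurzweil_Integration.integral_cong powr_mult)
    then show ?thesis
      using that \<open>0 < \<alpha>\<close> cont by (simp add: frac_integral_rescaled N_def powr_add)
  qed
  have "((\<lambda>s. (1 - s) powr (\<alpha> - 1) * s powr p) has_integral Beta (p + 1) \<alpha>) {0..1}"
    using has_integral_Beta_real[of "p + 1" \<alpha>] assms by (simp add: mult.commute)
  then have "frac_integral \<alpha> (\<lambda>s. s powr p) 1 = Gamma (p + 1) / Gamma (p + \<alpha> + 1)"
    using Gamma_real_pos[OF \<open>0 < \<alpha>\<close>]
    by (simp add: frac_integral_def integral_unique Beta_def add_ac)
  with scaled[of 1] scaled[OF \<open>0 \<le> t\<close>] show ?thesis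
    by simp
qed

text \<open>
  The powers \<open>(s\<^sup>\<alpha>)\<^sup>k\<close> are the terms of the Mittag-Leffler series. At \<open>k = 0\<close>, \<open>s = 0\<close> this
  form has the value 1, unlike \<open>0 powr 0 = 0\<close>, so \<open>k = 0\<close> is treated as a constant function.
\<close>
lemma frac_integral_powr_power:
  assumes "0 < \<alpha>" and "0 \<le> t"
  shows "frac_integral \<alpha> (\<lambda>s. (s powr \<alpha>) ^ k) t
    = Gamma (\<alpha> * real k + 1) / Gamma (\<alpha> * real (Suc k) + 1) * (t powr \<alpha>) ^ Suc k"
proof (cases "k = 0")
  case True
  then show ?thesis using assms by (simp add: frac_integral_const)
next
  case False
  have "(s powr \<alpha>) ^ n = s powr (\<alpha> * real n)" if "n > 0" for s n
    using that by (cases "s = 0") (auto simp: powr_realpow[symmetric] powr_powr)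
  then show ?thesis
    using False assms frac_integral_powr[of \<alpha> "\<alpha> * real k" t] by (simp add: algebra_simps del: power_Suc)
qed

section \<open>The Mittag-Leffler function\<close>

text \<open>
  Restrict Euler's integral for \<open>\<Gamma>(x + 1)\<close> to \<open>t \<ge> R\<close>, where \<open>t\<^sup>x \<ge> R\<^sup>x\<close>. As \<open>R\<close> is free, this
  says that \<open>\<Gamma>\<close> outgrows every exponential, which is what convergence of the Mittag-Leffler
  series requires.
\<close>
lemma Gamma_lower_bound:
  fixes R x :: real
  assumes "R > 0" and "x \<ge> 0"
  shows "R powr x * exp (- R) \<le> Gamma (x + 1)"
proof (rule has_integral_le)
  show "((\<lambda>t. if t \<in> {R..} then R powr x * exp (-1 * t) else 0) has_integral R powr x * exp (- R)) {0..}"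
    using has_integral_mult_right[OF has_integral_exp_minus_to_infinity[of 1 R], of "R powr x"] \<open>R > 0\<close>
    by (subst has_integral_restrict) auto
  show "((\<lambda>t. t powr (x + 1 - 1) / exp t) has_integral Gamma (x + 1)) {0..}"
    using Gamma_integral_real[of "x + 1"] \<open>x \<ge> 0\<close> by simp
  show "(if t \<in> {R..} then R powr x * exp (-1 * t) else 0) \<le> t powr (x + 1 - 1) / exp t" for t
    using assms by (auto simp: exp_minus field_simps intro!: powr_mono2)
qed

lemma Gamma_mittag_leffler_pos:
  fixes \<alpha> :: real
  assumes "0 < \<alpha>"
  shows "0 < Gamma (\<alpha> * real k + 1)"
  using assms by (intro Gamma_real_pos add_nonneg_pos) auto

lemma summable_mittag_leffler:
  fixes u :: real
  assumes "0 < \<alpha>" and "0 \<le> u"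
  shows "summable (\<lambda>k. u ^ k / Gamma (\<alpha> * real k + 1))"
proof -
  \<comment> \<open>With \<open>R\<^sup>\<alpha> = 2 u + 1\<close> the series is dominated by a geometric one of ratio below \<open>1/2\<close>.\<close>
  define R where "R = (2 * u + 1) powr (1 / \<alpha>)"
  have R: "R > 0" "R powr \<alpha> = 2 * u + 1"
    using assms by (auto simp: R_def powr_powr)
  have "summable (\<lambda>k. exp R * (u / (2 * u + 1)) ^ k)"
    using assms by (intro summable_mult summable_geometric) auto
  then show ?thesis
  proof (rule summable_comparison_test')
    fix k :: nat assume "k \<ge> 0"
    have "(2 * u + 1) ^ k * exp (- R) = R powr (\<alpha> * real k) * exp (- R)"
      using R assms by (simp add: powr_powr[symmetric] powr_realpow add_nonneg_pos)
    also have "\<dots> \<le> Gamma (\<alpha> * real k + 1)"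
      using R assms by (intro Gamma_lower_bound) auto
    finally have "u ^ k / Gamma (\<alpha> * real k + 1) \<le> u ^ k / ((2 * u + 1) ^ k * exp (- R))"
      using assms by (intro divide_left_mono mult_pos_pos Gamma_real_pos) (auto intro!: add_nonneg_pos)
    also have "\<dots> = exp R * (u / (2 * u + 1)) ^ k"
      by (simp add: exp_minus power_divide field_simps)
    finally show "norm (u ^ k / Gamma (\<alpha> * real k + 1)) \<le> exp R * (u / (2 * u + 1)) ^ k"
      using assms Gamma_real_pos[of "\<alpha> * real k + 1"] by (simp add: add_nonneg_pos)
  qed
qed

lemma mittag_leffler_uniform_limit:
  assumes "0 < \<alpha>"
  shows "uniform_limit {0..U} (\<lambda>n u. \<Sum>k<n. u ^ k / Gamma (\<alpha> * real k + 1))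
    (mittag_leffler \<alpha>) sequentially"
proof (cases "0 \<le> U")
  case True
  have "norm (u ^ k / Gamma (\<alpha> * real k + 1)) \<le> U ^ k / Gamma (\<alpha> * real k + 1)"
    if "u \<in> {0..U}" for u k
    using that assms Gamma_real_pos[of "\<alpha> * real k + 1"]
    by (auto simp: add_nonneg_pos intro!: divide_right_mono power_mono)
  then show ?thesis
    unfolding mittag_leffler_def[abs_def]
    by (rule Weierstrass_m_test) (use summable_mittag_leffler[OF assms True] in auto)
qed simp

lemma continuous_on_mittag_leffler:
  assumes "0 < \<alpha>"
  shows "continuous_on {0..U} (mittag_leffler \<alpha>)"
  by (rule uniform_limit_theorem[OF _ mittag_leffler_uniform_limit[OF assms]])
     (use Gamma_mittag_leffler_pos[OF assms] in
      \<open>auto intro!: always_eventually continuous_intros simp: less_imp_neq[symmetric]\<close>)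

lemma continuous_on_mittag_leffler_powr:
  assumes "0 < \<alpha>" and "0 \<le> \<theta>"
  shows "continuous_on {0..T} (\<lambda>t. mittag_leffler \<alpha> (\<theta> * t powr \<alpha>))"
proof (rule continuous_on_compose2[OF continuous_on_mittag_leffler[OF \<open>0 < \<alpha>\<close>]])
  show "continuous_on {0..T} (\<lambda>t. \<theta> * t powr \<alpha>)"
    using assms by (intro continuous_intros continuous_on_powr') auto
  show "(\<lambda>t. \<theta> * t powr \<alpha>) ` {0..T} \<subseteq> {0..\<theta> * T powr \<alpha>}"
    using assms by (auto intro!: mult_left_mono powr_mono2)
qed

lemma mittag_leffler_ge_1:
  assumes "0 < \<alpha>" and "0 \<le> u"
  shows "1 \<le> mittag_leffler \<alpha> u"
  using sum_le_suminf[OF summable_mittag_leffler[OF assms], of "{0}"] assms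
  by (force simp: mittag_leffler_def intro!: divide_nonneg_nonneg less_imp_le[OF Gamma_real_pos] add_nonneg_pos)

text \<open>
  The fractional integral maps the \<open>k\<close>-th term of the series to \<open>1 / \<theta>\<close> times the next term,
  so it shifts the series by one place and only the leading term 1 is lost.
\<close>
lemma frac_integral_mittag_leffler:
  assumes "0 < \<alpha>" and "0 < \<theta>" and "0 \<le> t"
  shows "frac_integral \<alpha> (\<lambda>s. mittag_leffler \<alpha> (\<theta> * s powr \<alpha>)) t
    = (mittag_leffler \<alpha> (\<theta> * t powr \<alpha>) - 1) / \<theta>"
proof -
  define P where "P n u = (\<Sum>k<n. u ^ k / Gamma (\<alpha> * real k + 1))" for n and u :: real
  have Gamma_ne: "Gamma (\<alpha> * real k + 1) \<noteq> 0" for k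
    using Gamma_mittag_leffler_pos[OF \<open>0 < \<alpha>\<close>, of k] by simp
  have P: "frac_integral \<alpha> (\<lambda>s. P n (\<theta> * s powr \<alpha>)) t = (P (Suc n) (\<theta> * t powr \<alpha>) - 1) / \<theta>" for n
  proof -
    have "frac_integral \<alpha> (\<lambda>s. P n (\<theta> * s powr \<alpha>)) t
        = (\<Sum>k<n. frac_integral \<alpha> (\<lambda>s. (\<theta> ^ k / Gamma (\<alpha> * real k + 1)) *\<^sub>R (s powr \<alpha>) ^ k) t)"
      using assms unfolding P_def
      by (subst frac_integral_sum[symmetric])
         (auto simp: power_mult_distrib Gamma_ne intro!: continuous_intros continuous_on_powr')
    also have "\<dots> = (\<Sum>k<n. (\<theta> * t powr \<alpha>) ^ Suc k / Gamma (\<alpha> * real (Suc k) + 1) / \<theta>)"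
    proof (rule sum.cong)
      fix k
      show "frac_integral \<alpha> (\<lambda>s. (\<theta> ^ k / Gamma (\<alpha> * real k + 1)) *\<^sub>R (s powr \<alpha>) ^ k) t
          = (\<theta> * t powr \<alpha>) ^ Suc k / Gamma (\<alpha> * real (Suc k) + 1) / \<theta>"
        unfolding frac_integral_scaleR frac_integral_powr_power[OF assms(1,3)]
        using assms Gamma_mittag_leffler_pos[OF \<open>0 < \<alpha>\<close>, of k]
        by (simp add: power_mult_distrib del: of_nat_Suc)
    qed simp
    also have "\<dots> = (P (Suc n) (\<theta> * t powr \<alpha>) - 1) / \<theta>"
      unfolding P_def sum.lessThan_Suc_shift sum_divide_distrib[symmetric] by simp
    finally show ?thesis .
  qed
  have lim: "uniform_limit {0..U} P (mittag_leffler \<alpha>) sequentially" for U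
    using mittag_leffler_uniform_limit[OF \<open>0 < \<alpha>\<close>] unfolding P_def .
  have "uniform_limit {0..t} (\<lambda>n s. P n (\<theta> * s powr \<alpha>))
      (\<lambda>s. mittag_leffler \<alpha> (\<theta> * s powr \<alpha>)) sequentially"
    by (rule uniform_limit_compose'[OF lim, of _ _ "\<theta> * t powr \<alpha>"])
       (use assms in \<open>auto intro!: mult_left_mono powr_mono2\<close>)
  then have "(\<lambda>n. frac_integral \<alpha> (\<lambda>s. P n (\<theta> * s powr \<alpha>)) t)
      \<longlonglongrightarrow> frac_integral \<alpha> (\<lambda>s. mittag_leffler \<alpha> (\<theta> * s powr \<alpha>)) t"
    using assms
    by (intro tendsto_frac_integral) (auto simp: P_def Gamma_ne intro!: continuous_intros continuous_on_powr')
  moreover have "(\<lambda>n. frac_integral \<alpha> (\<lambda>s. P n (\<theta> * s powr \<alpha>)) t)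
      \<longlonglongrightarrow> (mittag_leffler \<alpha> (\<theta> * t powr \<alpha>) - 1) / \<theta>"
    unfolding P
    by (intro tendsto_intros LIMSEQ_Suc tendsto_uniform_limitI[OF lim[of "\<theta> * t powr \<alpha>"]])
       (use assms in auto)
  ultimately show ?thesis by (rule LIMSEQ_unique)
qed

section \<open>The stability estimate\<close>

text \<open>
  A Gronwall-type inequality. The maximum on the right, with constant 1 in front of
  \<open>norm d\<close>, comes from keeping the \<open>-1\<close> in \<open>I\<^sup>\<alpha> E = (E - 1) / \<theta>\<close>: a Bielecki norm \<open>B\<close>
  exceeding both terms would satisfy \<open>B E(\<tau>) < B + B (E(\<tau>) - 1)\<close> at a point \<open>\<tau>\<close> where it is
  attained.
\<close>
lemma norm_le_mittag_leffler_of_implicit_inequality: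
  fixes \<zeta> :: "real \<Rightarrow> 'a::banach" and d :: 'a
  assumes "0 < \<alpha>" and "0 \<le> T" and "0 \<le> M2" and "M3 < 1" and "0 < \<theta>" and "M2 / \<theta> + M3 < 1"
    and "0 \<le> K" and \<zeta>: "continuous_on {0..T} \<zeta>"
    and ineq: "\<And>t. t \<in> {0..T} \<Longrightarrow>
      norm (\<zeta> t) \<le> K + M2 * norm (d + frac_integral \<alpha> \<zeta> t) + M3 * norm (\<zeta> t)"
    and t: "t \<in> {0..T}"
  shows "norm (d + frac_integral \<alpha> \<zeta> t)
    \<le> max (norm d) (K / (\<theta> * (1 - (M2 / \<theta> + M3)))) * mittag_leffler \<alpha> (\<theta> * t powr \<alpha>)"
proof -
  define E where "E t = mittag_leffler \<alpha> (\<theta> * t powr \<alpha>)" for t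
  define D where "D t = d + frac_integral \<alpha> \<zeta> t" for t
  define \<mu> where "\<mu> = \<theta> * (1 - M3)"
  have \<mu>: "0 < \<mu>" "M2 < \<mu>" "\<theta> * (1 - (M2 / \<theta> + M3)) = \<mu> - M2"
    using assms by (auto simp: \<mu>_def field_simps)
  have E1: "1 \<le> E s" for s
    using mittag_leffler_ge_1 assms by (simp add: E_def)
  have Epos: "0 < E s" for s
    using E1[of s] by linarith
  have E: "continuous_on {0..T} E"
    unfolding E_def using continuous_on_mittag_leffler_powr assms by simp
  have "continuous_on {0..T} (\<lambda>t. norm (D t) / E t)"
    unfolding D_def using Epos
    by (intro continuous_intros continuous_on_frac_integral E \<zeta> \<open>0 < \<alpha>\<close>) (metis less_irrefl)
  then obtain \<tau> where \<tau>: "\<tau> \<in> {0..T}"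
    and max: "\<And>s. s \<in> {0..T} \<Longrightarrow> norm (D s) / E s \<le> norm (D \<tau>) / E \<tau>"
    using continuous_attains_sup[of "{0..T}" "\<lambda>t. norm (D t) / E t"] \<open>0 \<le> T\<close> by auto
  define B where "B = norm (D \<tau>) / E \<tau>"
  have D: "norm (D s) \<le> B * E s" if "s \<in> {0..T}" for s
    using max[OF that] Epos[of s] by (simp add: B_def pos_divide_le_eq)
  have "B \<le> max (norm d) (K / (\<mu> - M2))"
  proof (rule ccontr)
    assume "\<not> ?thesis"
    then have B: "norm d < B" "K / (\<mu> - M2) < B" by auto
    then have KB: "K + M2 * B < \<mu> * B"
      using \<mu> by (simp add: field_simps)
    have "0 \<le> B" using B(1) norm_ge_zero[of d] by linarith
    define c where "c = (K + M2 * B) / (1 - M3)"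
    have "norm (\<zeta> s) \<le> c * E s" if "s \<in> {0..T}" for s
    proof -
      have "norm (\<zeta> s) * (1 - M3) \<le> K + M2 * norm (D s)"
        using ineq[OF that] by (simp add: D_def algebra_simps)
      also have "\<dots> \<le> K * E s + M2 * (B * E s)"
        using E1[of s] D[OF that] assms by (intro add_mono mult_left_mono mult_right_le_one_le) (auto simp: mult_le_cancel_left1)
      finally show ?thesis
        using \<open>M3 < 1\<close> by (simp add: c_def field_simps)
    qed
    then have "norm (frac_integral \<alpha> \<zeta> \<tau>) \<le> frac_integral \<alpha> (\<lambda>s. c * E s) \<tau>"
      using \<tau> \<open>0 < \<alpha>\<close> E \<zeta>
      by (intro norm_frac_integral_le) (auto intro!: continuous_intros intro: continuous_on_subset)
    also have "\<dots> = c * ((E \<tau> - 1) / \<theta>)"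
      using frac_integral_scaleR[of \<alpha> c E \<tau>] frac_integral_mittag_leffler[of \<alpha> \<theta> \<tau>] assms \<tau>
      by (simp add: E_def[abs_def])
    also have "\<dots> = (K + M2 * B) / \<mu> * (E \<tau> - 1)"
      by (simp add: c_def \<mu>_def)
    also have "\<dots> \<le> B * (E \<tau> - 1)"
      using KB \<mu> E1[of \<tau>] by (intro mult_right_mono) (auto simp: field_simps)
    finally have "norm (D \<tau>) \<le> norm d + B * (E \<tau> - 1)"
      unfolding D_def by (intro norm_triangle_le) simp
    also have "\<dots> < B * E \<tau>"
      using B(1) by (simp add: algebra_simps)
    finally show False
      using Epos[of \<tau>] by (simp add: B_def)
  qed
  then have "B * E t \<le> max (norm d) (K / (\<mu> - M2)) * E t"
    using Epos[of t] by (intro mult_right_mono) auto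
  with D[OF t] show ?thesis
    unfolding \<mu>(3) E_def D_def by linarith
qed

section \<open>Existence of solutions\<close>

text \<open>
  Banach's fixed point theorem on bounded continuous functions on the whole line. Composing
  with the retraction \<open>c\<close> of the line onto \<open>[0, T]\<close> extends the operator to that space
  without changing it on \<open>[0, T]\<close>.
\<close>
lemma ex_implicit_fractional_fixpoint:
  fixes h :: "real \<Rightarrow> 'a::banach \<Rightarrow> 'a \<Rightarrow> 'a" and w :: 'a
  assumes "0 < \<alpha>" and "0 \<le> T" and "0 \<le> M2" and "0 \<le> M3"
    and h: "continuous_on ({0..T} \<times> UNIV \<times> UNIV) (\<lambda>(t, x, y). h t x y)"
    and lip: "\<And>t x1 x2 y1 y2. t \<in> {0..T} \<Longrightarrow>
      norm (h t x1 y1 - h t x2 y2) \<le> M2 * norm (x1 - x2) + M3 * norm (y1 - y2)"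
    and contr: "M2 / Gamma (\<alpha> + 1) * T powr \<alpha> + M3 < 1"
  obtains z where "continuous_on {0..T} z"
    and "\<And>t. t \<in> {0..T} \<Longrightarrow> z t = h t (w + frac_integral \<alpha> z t) (z t)"
proof -
  define c where "c t = max 0 (min T t)" for t
  have c: "c t \<in> {0..T}" for t using \<open>0 \<le> T\<close> by (auto simp: c_def)
  have c_id: "c t = t" if "t \<in> {0..T}" for t using that by (auto simp: c_def)
  have c_cont: "continuous_on UNIV c" unfolding c_def by (intro continuous_intros)
  define \<phi> where "\<phi> z t = h t (w + frac_integral \<alpha> z t) (z t)" for z t
  define \<Phi> where "\<Phi> z = Bcontfun (\<lambda>t. \<phi> (apply_bcontfun z) (c t))" for z
  define L where "L = M2 / Gamma (\<alpha> + 1) * T powr \<alpha> + M3"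
  have \<phi>: "continuous_on {0..T} (\<phi> z)" if "continuous_on {0..T} z" for z
  proof -
    have "continuous_on {0..T} (\<lambda>t. (\<lambda>(t, x, y). h t x y) (t, w + frac_integral \<alpha> z t, z t))"
      by (rule continuous_on_compose2[OF h])
         (auto intro!: continuous_intros continuous_on_frac_integral that \<open>0 < \<alpha>\<close>)
    then show ?thesis by (simp add: \<phi>_def[abs_def])
  qed
  have \<Phi>: "apply_bcontfun (\<Phi> z) t = \<phi> (apply_bcontfun z) (c t)" for z t
  proof -
    have cont: "continuous_on {0..T} (\<phi> (apply_bcontfun z))"
      by (rule \<phi>) simp
    obtain b where "\<And>t. t \<in> {0..T} \<Longrightarrow> norm (\<phi> (apply_bcontfun z) t) \<le> b"
      using compact_imp_bounded[OF compact_continuous_image[OF cont compact_Icc]]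
      unfolding bounded_iff by blast
    then have "(\<lambda>t. \<phi> (apply_bcontfun z) (c t)) \<in> bcontfun"
      using c by (intro bcontfun_normI continuous_on_compose2[OF cont c_cont]) auto
    then show ?thesis unfolding \<Phi>_def by (simp add: Bcontfun_inverse)
  qed
  have "dist (\<Phi> z1) (\<Phi> z2) \<le> L * dist z1 z2" for z1 z2
  proof (rule dist_bound)
    fix t :: real
    let ?z1 = "apply_bcontfun z1" and ?z2 = "apply_bcontfun z2" and ?r = "dist z1 z2"
    have r: "norm (?z1 s - ?z2 s) \<le> ?r" for s
      using dist_bounded[of z1 s z2] by (simp add: dist_norm)
    have "norm (frac_integral \<alpha> (\<lambda>s. ?z1 s - ?z2 s) (c t)) \<le> frac_integral \<alpha> (\<lambda>_. ?r) (c t)"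
      using \<open>0 < \<alpha>\<close> c[of t] r by (intro norm_frac_integral_le) (auto intro!: continuous_intros)
    also have "\<dots> \<le> T powr \<alpha> / Gamma (\<alpha> + 1) * ?r"
      using \<open>0 < \<alpha>\<close> c[of t] Gamma_real_pos[of "\<alpha> + 1"]
      by (auto simp: frac_integral_const intro!: mult_right_mono divide_right_mono powr_mono2)
    finally have I: "norm (frac_integral \<alpha> ?z1 (c t) - frac_integral \<alpha> ?z2 (c t))
        \<le> T powr \<alpha> / Gamma (\<alpha> + 1) * ?r"
      using \<open>0 < \<alpha>\<close> c[of t] by (simp add: frac_integral_diff)
    have "dist (\<Phi> z1 t) (\<Phi> z2 t) \<le> M2 * norm (frac_integral \<alpha> ?z1 (c t) - frac_integral \<alpha> ?z2 (c t))
        + M3 * norm (?z1 (c t) - ?z2 (c t))"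
      using lip[OF c, of t "w + frac_integral \<alpha> ?z1 (c t)" "?z1 (c t)"
          "w + frac_integral \<alpha> ?z2 (c t)" "?z2 (c t)"]
      unfolding \<Phi> \<phi>_def dist_norm by simp
    also have "\<dots> \<le> M2 * (T powr \<alpha> / Gamma (\<alpha> + 1) * ?r) + M3 * ?r"
      using I r assms by (intro add_mono mult_left_mono) auto
    finally show "dist (\<Phi> z1 t) (\<Phi> z2 t) \<le> L * ?r"
      by (simp add: L_def algebra_simps)
  qed
  moreover have "0 \<le> L" "L < 1"
    using assms Gamma_real_pos[of "\<alpha> + 1"] by (auto simp: L_def)
  ultimately obtain z where "\<Phi> z = z"
    using banach_fix_type[of L \<Phi>] by blast
  then have "apply_bcontfun z t = \<phi> (apply_bcontfun z) t" if "t \<in> {0..T}" for t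
    using \<Phi>[of z t] c_id[OF that] by simp
  then show thesis
    by (intro that[of "apply_bcontfun z"]) (auto simp: \<phi>_def)
qed

lemma caputo_solution_exists:
  fixes h :: "real \<Rightarrow> 'a::banach \<Rightarrow> 'a \<Rightarrow> 'a"
  assumes "0 < \<alpha>" and "0 \<le> T" and "0 \<le> M2" and "0 \<le> M3"
    and "continuous_on ({0..T} \<times> UNIV \<times> UNIV) (\<lambda>(t, x, y). h t x y)"
    and "\<And>t x1 x2 y1 y2. t \<in> {0..T} \<Longrightarrow>
      norm (h t x1 y1 - h t x2 y2) \<le> M2 * norm (x1 - x2) + M3 * norm (y1 - y2)"
    and "M2 / Gamma (\<alpha> + 1) * T powr \<alpha> + M3 < 1"
  shows "\<exists>x. caputo_solution \<alpha> T h w x"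
proof -
  obtain z where z: "continuous_on {0..T} z"
    "\<And>t. t \<in> {0..T} \<Longrightarrow> z t = h t (w + frac_integral \<alpha> z t) (z t)"
    using ex_implicit_fractional_fixpoint[OF assms] by metis
  then have "caputo_solution \<alpha> T h w (restrict (\<lambda>t. w + frac_integral \<alpha> z t) {0..T})"
    unfolding caputo_solution_def by (auto intro!: exI[of _ z])
  then show ?thesis by blast
qed

section \<open>Comparison and uniqueness of solutions\<close>

text \<open>
  Splitting \<open>f(x, u) - g(y, v)\<close> at \<open>g(x, u)\<close> puts the defect \<open>K\<close> and the Lipschitz bound of
  \<open>g\<close> into the implicit inequality for \<open>u - v\<close>.
\<close>
lemma caputo_solutions_dist_le:
  fixes f g :: "real \<Rightarrow> 'a::banach \<Rightarrow> 'a \<Rightarrow> 'a"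
  assumes "0 < \<alpha>" and "0 \<le> T" and "0 \<le> M2" and "M3 < 1" and "0 < \<theta>" and "M2 / \<theta> + M3 < 1"
    and "0 \<le> K"
    and lip: "\<And>t x1 x2 y1 y2. t \<in> {0..T} \<Longrightarrow>
      norm (g t x1 y1 - g t x2 y2) \<le> M2 * norm (x1 - x2) + M3 * norm (y1 - y2)"
    and close: "\<And>t x y. t \<in> {0..T} \<Longrightarrow> norm (f t x y - g t x y) \<le> K"
    and x: "caputo_solution \<alpha> T f x0 x" and y: "caputo_solution \<alpha> T g y0 y"
    and t: "t \<in> {0..T}"
  shows "norm (x t - y t) \<le> max (norm (x0 - y0)) (K / (\<theta> * (1 - (M2 / \<theta> + M3))))
    * mittag_leffler \<alpha> (\<theta> * t powr \<alpha>)"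
proof -
  obtain u where u: "continuous_on {0..T} u" "\<And>t. t \<in> {0..T} \<Longrightarrow> u t = f t (x t) (u t)"
    "\<And>t. t \<in> {0..T} \<Longrightarrow> x t = x0 + frac_integral \<alpha> u t"
    using x unfolding caputo_solution_def by metis
  obtain v where v: "continuous_on {0..T} v" "\<And>t. t \<in> {0..T} \<Longrightarrow> v t = g t (y t) (v t)"
    "\<And>t. t \<in> {0..T} \<Longrightarrow> y t = y0 + frac_integral \<alpha> v t"
    using y unfolding caputo_solution_def by metis
  have diff: "x s - y s = (x0 - y0) + frac_integral \<alpha> (\<lambda>s. u s - v s) s" if "s \<in> {0..T}" for s
    using that u(1,3) v(1,3) \<open>0 < \<alpha>\<close>
    by (subst frac_integral_diff) (auto intro: continuous_on_subset)
  have "norm (u s - v s) \<le> K + M2 * norm (x s - y s) + M3 * norm (u s - v s)" if s: "s \<in> {0..T}" for s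
  proof -
    have "u s - v s = (f s (x s) (u s) - g s (x s) (u s)) + (g s (x s) (u s) - g s (y s) (v s))"
      using u(2)[OF s] v(2)[OF s] by simp
    then have "norm (u s - v s)
        \<le> norm (f s (x s) (u s) - g s (x s) (u s)) + norm (g s (x s) (u s) - g s (y s) (v s))"
      by (metis norm_triangle_ineq)
    then show ?thesis
      using close[OF s, of "x s" "u s"] lip[OF s, of "x s" "u s" "y s" "v s"] by linarith
  qed
  then show ?thesis
    unfolding diff[OF t]
    by (intro norm_le_mittag_leffler_of_implicit_inequality[OF assms(1-7) _ _ t])
       (use u(1) v(1) diff in \<open>auto intro!: continuous_intros\<close>)
qed

text \<open>
  The comparison estimate with \<open>f = g\<close>, equal initial values and \<open>K = 0\<close>.
\<close>
lemma caputo_solution_unique: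
  fixes h :: "real \<Rightarrow> 'a::banach \<Rightarrow> 'a \<Rightarrow> 'a"
  assumes "0 < \<alpha>" and "0 \<le> T" and "0 \<le> M2" and "M3 < 1" and "0 < \<theta>" and "M2 / \<theta> + M3 < 1"
    and lip: "\<And>t x1 x2 y1 y2. t \<in> {0..T} \<Longrightarrow>
      norm (h t x1 y1 - h t x2 y2) \<le> M2 * norm (x1 - x2) + M3 * norm (y1 - y2)"
    and x: "caputo_solution \<alpha> T h w x" and y: "caputo_solution \<alpha> T h w y"
  shows "x = y"
proof (rule extensionalityI)
  show "x \<in> extensional {0..T}" "y \<in> extensional {0..T}"
    using x y by (auto simp: caputo_solution_def)
  fix t assume "t \<in> {0..T}"
  from caputo_solutions_dist_le[OF assms(1-6) order_refl lip _ x y this] show "x t = y t"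
    by simp
qed

section \<open>Continuous dependence in the Bielecki norm\<close>

theorem theorem3p3:
  fixes f g :: "real \<Rightarrow> 'a::banach \<Rightarrow> 'a \<Rightarrow> 'a"
    and x0 y0 :: 'a
    and T \<alpha> M1 M2 M3 \<theta> :: real
    and \<eta> :: "real \<Rightarrow> real"
  assumes "T > 0" and "0 < \<alpha>" and "\<alpha> < 1"
    and "M1 > 0" and "M2 > 0" and "0 < M3" and "M3 < 1"
    and "\<forall>h\<in>{f, g}. continuous_on ({0..T} \<times> UNIV \<times> UNIV) (\<lambda>(t, x, y). h t x y)"
    and "\<forall>h\<in>{f, g}. \<forall>t1\<in>{0..T}. \<forall>t2\<in>{0..T}. \<forall>x1 x2 y1 y2.
           norm (h t1 x1 y1 - h t2 x2 y2)
             \<le> M1 * \<bar>t1 - t2\<bar> + M2 * norm (x1 - x2) + M3 * norm (y1 - y2)"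
    and "\<forall>t\<in>{0..T}. \<eta> t \<ge> 0"
    and "\<eta> absolutely_integrable_on {0..T}"
    and "continuous_on {0..T} \<eta>"
    and "\<forall>t\<in>{0..T}. \<forall>x y. norm (f t x y - g t x y) \<le> \<eta> t"
    and "M2 / Gamma (\<alpha> + 1) * T powr \<alpha> + M3 < 1"
    and "\<theta> > 0" and "M2 / \<theta> + M3 < 1"
  shows "(\<exists>!x. caputo_solution \<alpha> T f x0 x) \<and>
         (\<exists>!y. caputo_solution \<alpha> T g y0 y) \<and>
         (\<forall>x y. caputo_solution \<alpha> T f x0 x \<longrightarrow> caputo_solution \<alpha> T g y0 y \<longrightarrow>
            bielecki_norm \<alpha> T \<theta> (\<lambda>t. x t - y t)
              \<le> norm (x0 - y0)
                 + (GREATEST k. k \<in> \<eta> ` {0..T}) / (\<theta> * (1 - (M2 / \<theta> + M3))))"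
proof -
  have lip: "norm (h t x1 y1 - h t x2 y2) \<le> M2 * norm (x1 - x2) + M3 * norm (y1 - y2)"
    if "h \<in> {f, g}" "t \<in> {0..T}" for h t x1 x2 y1 y2
    using assms(9)[rule_format, OF that that(2), of x1 y1 x2 y2] by simp
  have "\<exists>!x. caputo_solution \<alpha> T h w x" if h: "h \<in> {f, g}" for h w
  proof (rule ex_ex1I)
    show "\<exists>x. caputo_solution \<alpha> T h w x"
      using assms h by (intro caputo_solution_exists[of \<alpha> T M2 M3] lip) auto
    show "x = y" if "caputo_solution \<alpha> T h w x" "caputo_solution \<alpha> T h w y" for x y
      using assms h that by (intro caputo_solution_unique[of \<alpha> T M2 M3 \<theta> h w x y] lip) auto
  qed
  moreover have "bielecki_norm \<alpha> T \<theta> (\<lambda>t. x t - y t)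
      \<le> norm (x0 - y0) + (GREATEST k. k \<in> \<eta> ` {0..T}) / (\<theta> * (1 - (M2 / \<theta> + M3)))"
    if x: "caputo_solution \<alpha> T f x0 x" and y: "caputo_solution \<alpha> T g y0 y" for x y
  proof -
    obtain \<tau> where \<tau>: "\<tau> \<in> {0..T}" "\<And>t. t \<in> {0..T} \<Longrightarrow> \<eta> t \<le> \<eta> \<tau>"
      using continuous_attains_sup[OF compact_Icc _ assms(12)] \<open>T > 0\<close> by auto
    have K: "(GREATEST k. k \<in> \<eta> ` {0..T}) = \<eta> \<tau>"
      using \<tau> by (intro Greatest_equality) auto
    have "0 \<le> \<eta> \<tau>" using assms(10) \<tau>(1) by blast
    then have C: "0 \<le> \<eta> \<tau> / (\<theta> * (1 - (M2 / \<theta> + M3)))"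
      using assms by (intro divide_nonneg_nonneg mult_nonneg_nonneg) auto
    have close: "norm (f t x y - g t x y) \<le> \<eta> \<tau>" if "t \<in> {0..T}" for t x y
      using assms(13) \<tau>(2) that by (meson order_trans)
    have "norm (x t - y t) / mittag_leffler \<alpha> (\<theta> * t powr \<alpha>)
        \<le> norm (x0 - y0) + \<eta> \<tau> / (\<theta> * (1 - (M2 / \<theta> + M3)))" if t: "t \<in> {0..T}" for t
    proof -
      have E: "0 < mittag_leffler \<alpha> (\<theta> * t powr \<alpha>)"
        using mittag_leffler_ge_1[of \<alpha> "\<theta> * t powr \<alpha>"] assms by simp
      have "norm (x t - y t) \<le> max (norm (x0 - y0)) (\<eta> \<tau> / (\<theta> * (1 - (M2 / \<theta> + M3))))
          * mittag_leffler \<alpha> (\<theta> * t powr \<alpha>)"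
        by (rule caputo_solutions_dist_le[where f = f and g = g])
           (use assms(1,2,5,7,15,16) \<open>0 \<le> \<eta> \<tau>\<close> lip close x y t in auto)
      then have "norm (x t - y t) / mittag_leffler \<alpha> (\<theta> * t powr \<alpha>)
          \<le> max (norm (x0 - y0)) (\<eta> \<tau> / (\<theta> * (1 - (M2 / \<theta> + M3))))"
        using E by (simp add: pos_divide_le_eq)
      then show ?thesis using C norm_ge_zero[of "x0 - y0"] by linarith
    qed
    then show ?thesis
      unfolding bielecki_norm_def K using \<open>T > 0\<close> by (intro cSUP_least) auto
  qed
  ultimately show ?thesis by blast
qed

end
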